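(* Let $\beta\in(0,2]$ and suppose that $f\in C^\beta(\mathbb{R})$ and $f\ge0$. Let $f^*$ be the restriction of $f$ to $[0,1]$. Then $f^*\in\mathcal{F}^\beta$ and $$|f^*|_{\mathcal{F}^\beta}\le 2^\beta\,|f|_{C^\beta(\mathbb{R})}.$$
   Context: For $\beta>0$, $\lfloor\beta\rfloor$ denotes the largest integer strictly smaller than $\beta$ (so $\lfloor 1\rfloor=0$, $\lfloor 2\rfloor=1$). For $\Omega\subset\mathbb{R}$ let $$|f|_{C^\beta(\Omega)}=\sup_{x\ne y,\;x,y\in\Omega}\frac{|f^{(\lfloor\beta\rfloor)}(x)-f^{(\lfloor\beta\rfloor)}(y)|}{|x-y|^{\beta-\lfloor\beta\rfloor}},\qquad \|f\|_{C^\beta(\Omega)}=\|f\|_\infty+\|f^{(\lfloor\beta\rfloor)}\|_\infty+|f|_{C^\beta(\Omega)},$$ and $C^\beta(\Omega)=\{f:\Omega\to\mathbb{R}: f^{(\lfloor\beta\rfloor)}\text{ exists},\ \|f\|_{C^\beta(\Omega)}<\infty\}$ (derivatives at endpoints of an interval are one-sided). For $f\in C^\beta([0,1])$, $f\ge0$, define $|f|_{\mathcal{F}^\beta}$ as the infimum over all real $\kappa\ge0$ such that $$|f^{(j)}(x)|^\beta\le \kappa^j|f(x)|^{\beta-j}\quad\text{for all }x\in[0,1]\text{ and all integers }1\le j<\beta,$$ with $|f|_{\mathcal{F}^\beta}=\infty$ if no such $\kappa$ exists, and $|f|_{\mathcal{F}^\beta}=0$ for $\beta\le1$. Set $\|f\|_{\mathcal{F}^\beta}=\|f\|_{C^\beta([0,1])}+|f|_{\mathcal{F}^\beta}$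 and $\mathcal{F}^\beta=\{f\in C^\beta([0,1]): f\ge0,\ \|f\|_{\mathcal{F}^\beta}<\infty\}$. *)

theory Defs
  imports "HOL-Analysis.Analysis"
begin

text \<open>The largest integer strictly smaller than a positive real (so 0 at 1, and 1 at 2). For
  positive arguments this integer is nonnegative, and a natural number can be used.\<close>

definition sfloor :: "real \<Rightarrow> nat" where
  "sfloor \<beta> = (GREATEST k. real k < \<beta>)"

lemma sfloor_eq_ceiling:
  assumes "0 < \<beta>"
  shows "sfloor \<beta> = nat (\<lceil>\<beta>\<rceil> - 1)"
  unfolding sfloor_def
proof (rule Greatest_equality)
  show "real (nat (\<lceil>\<beta>\<rceil> - 1)) < \<beta>"
    using assms by linarith
  show "k \<le> nat (\<lceil>\<beta>\<rceil> - 1)" if "real k < \<beta>" for k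
    using that by linarith
qed

text \<open>Functions on \<open>\<Omega> \<subseteq> \<real>\<close> are total functions of which only the values on \<open>\<Omega>\<close> matter.
  Derivatives are taken within \<open>\<Omega>\<close>, hence are one-sided at the endpoints of a closed interval.
  They are unique, and independent of the choice made by \<^const>\<open>vector_derivative\<close>, as long as
  \<open>\<Omega>\<close> has no isolated points; the sets of interest are \<open>\<real>\<close> and \<open>[0,1]\<close>.\<close>

primrec nth_deriv_on :: "real set \<Rightarrow> nat \<Rightarrow> (real \<Rightarrow> real) \<Rightarrow> real \<Rightarrow> real" where
  "nth_deriv_on \<Omega> 0 f = f"
| "nth_deriv_on \<Omega> (Suc k) f = (\<lambda>x. vector_derivative (nth_deriv_on \<Omega> k f) (at x within \<Omega>))"

definition nth_differentiable_on :: "real set \<Rightarrow> nat \<Rightarrow> (real \<Rightarrow> real) \<Rightarrow> bool" where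
  "nth_differentiable_on \<Omega> k f \<longleftrightarrow> (\<forall>j<k. nth_deriv_on \<Omega> j f differentiable_on \<Omega>)"

lemma nth_deriv_on_UNIV: "nth_deriv_on UNIV k f = (deriv ^^ k) f"
proof (induction k)
  case (Suc k)
  have "vector_derivative g (at x) = deriv g x" for g :: "real \<Rightarrow> real" and x
    by (simp add: deriv_def vector_derivative_def has_real_derivative_iff_has_vector_derivative)
  with Suc show ?case by simp
qed simp

text \<open>Norms and seminorms take values in \<open>[0,\<infinity>]\<close>, so that suprema and infima always exist;
  in particular the supremum of the empty set is \<open>0\<close> and the infimum of the empty set is \<open>\<infinity>\<close>.\<close>

definition sup_norm :: "real set \<Rightarrow> (real \<Rightarrow> real) \<Rightarrow> ennreal" where
  "sup_norm \<Omega> f = (SUP x\<in>\<Omega>. ennreal \<bar>f x\<bar>)"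

definition holder_seminorm :: "real \<Rightarrow> real set \<Rightarrow> (real \<Rightarrow> real) \<Rightarrow> ennreal" where
  "holder_seminorm \<beta> \<Omega> f =
     (SUP (x, y) \<in> {(x, y). x \<in> \<Omega> \<and> y \<in> \<Omega> \<and> x \<noteq> y}.
        ennreal (\<bar>nth_deriv_on \<Omega> (sfloor \<beta>) f x - nth_deriv_on \<Omega> (sfloor \<beta>) f y\<bar>
                 / \<bar>x - y\<bar> powr (\<beta> - real (sfloor \<beta>))))"

definition holder_norm :: "real \<Rightarrow> real set \<Rightarrow> (real \<Rightarrow> real) \<Rightarrow> ennreal" where
  "holder_norm \<beta> \<Omega> f =
     sup_norm \<Omega> f + sup_norm \<Omega> (nth_deriv_on \<Omega> (sfloor \<beta>) f) + holder_seminorm \<beta> \<Omega> f"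

definition holder_space :: "real \<Rightarrow> real set \<Rightarrow> (real \<Rightarrow> real) set" where
  "holder_space \<beta> \<Omega> = {f. nth_differentiable_on \<Omega> (sfloor \<beta>) f \<and> holder_norm \<beta> \<Omega> f < \<infinity>}"

text \<open>All exponents \<open>\<beta> - j\<close> below are positive, so \<open>0 powr (\<beta> - j) = 0\<close> has its usual meaning.\<close>

definition flat_seminorm :: "real \<Rightarrow> (real \<Rightarrow> real) \<Rightarrow> ennreal" where
  "flat_seminorm \<beta> f =
     (if \<beta> \<le> 1 then 0
      else Inf {ennreal \<kappa> | \<kappa>. 0 \<le> \<kappa> \<and>
             (\<forall>x\<in>{0..1}. \<forall>j::nat. 1 \<le> j \<and> real j < \<beta> \<longrightarrow>
                \<bar>nth_deriv_on {0..1} j f x\<bar> powr \<beta> \<le> \<kappa> ^ j * \<bar>f x\<bar> powr (\<beta> - real j))})"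

definition flat_norm :: "real \<Rightarrow> (real \<Rightarrow> real) \<Rightarrow> ennreal" where
  "flat_norm \<beta> f = holder_norm \<beta> {0..1} f + flat_seminorm \<beta> f"

definition flat_space :: "real \<Rightarrow> (real \<Rightarrow> real) set" where
  "flat_space \<beta> =
     {f \<in> holder_space \<beta> {0..1}. (\<forall>x\<in>{0..1}. 0 \<le> f x) \<and> flat_norm \<beta> f < \<infinity>}"

end

theory Submission
  imports Defs
begin

text \<open>
  Restricting \<open>f\<close> to \<open>[0,1]\<close> changes none of its derivatives there, since a one-sided derivative
  of a differentiable function is its derivative; so the Hoelder norm can only decrease, and all
  the content is the bound on the flatness seminorm. For \<open>\<beta> \<le> 1\<close> that seminorm is zero. For
  \<open>1 < \<beta> \<le> 2\<close> only \<open>j = 1\<close> occurs, and the claim is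
  \<open>\<bar>f' x\<bar> powr \<beta> \<le> 2 powr \<beta> * M * f x powr (\<beta> - 1)\<close>, where \<open>M\<close> is the Hoelder seminorm.

  The reason is that a nonnegative function with a large slope at a point where it is small would
  become negative a little further downhill, unless the slope changed quickly. Walk from \<open>x\<close> a
  distance \<open>h\<close> in the direction in which \<open>f\<close> decreases. Along the way the slope stays at least
  \<open>\<bar>f' x\<bar> - M * h powr (\<beta> - 1)\<close>, so \<open>h * (\<bar>f' x\<bar> - M * h powr (\<beta> - 1)) \<le> f x\<close>
  (\<open>descent_le_value\<close>). Choosing \<open>h\<close> such that the slope has at least half its initial size
  gives the claim with the constant \<open>2 powr \<beta>\<close> (\<open>deriv_powr_le\<close>). The walk may leave \<open>[0,1]\<close>,
  which is why \<open>f\<close> has to be nonnegative and Hoelder smooth on the whole line.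
\<close>

lemma sfloor_eq_1: "1 < \<beta> \<Longrightarrow> \<beta> \<le> 2 \<Longrightarrow> sfloor \<beta> = 1"
proof -
  assume "1 < \<beta>" "\<beta> \<le> 2"
  then have "\<lceil>\<beta>\<rceil> = 2" by linarith
  with \<open>1 < \<beta>\<close> show ?thesis by (simp add: sfloor_eq_ceiling)
qed

lemma nth_deriv_on_interval_eq:
  assumes "a < b" and "nth_differentiable_on UNIV k f"
    and eq: "\<And>x. x \<in> {a..b} \<Longrightarrow> g x = f x"
    and "j \<le> k" and "x \<in> {a..b}"
  shows "nth_deriv_on {a..b} j g x = nth_deriv_on UNIV j f x"
  using \<open>j \<le> k\<close> \<open>x \<in> {a..b}\<close>
proof (induction j arbitrary: x)
  case 0
  then show ?case by (simp add: eq)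
next
  case (Suc j)
  let ?F = "nth_deriv_on UNIV j f"
  have "?F differentiable (at x)"
    using assms(2) Suc.prems by (auto simp: nth_differentiable_on_def differentiable_on_def)
  then have "(?F has_vector_derivative vector_derivative ?F (at x)) (at x within {a..b})"
    by (meson has_vector_derivative_at_within vector_derivative_works)
  then have "(nth_deriv_on {a..b} j g has_vector_derivative vector_derivative ?F (at x))
      (at x within {a..b})"
    by (rule has_vector_derivative_transform[OF Suc.prems(2), rotated])
       (use Suc in auto)
  with \<open>a < b\<close> Suc.prems show ?case
    by (auto intro!: vector_derivative_within_closed_interval)
qed

lemma nth_differentiable_on_interval:
  assumes "a < b" and "nth_differentiable_on UNIV k f"
    and eq: "\<And>x. x \<in> {a..b} \<Longrightarrow> g x = f x"
  shows "nth_differentiable_on {a..b} k g"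
  unfolding nth_differentiable_on_def
proof (intro allI impI)
  fix j assume "j < k"
  then have "nth_deriv_on UNIV j f differentiable_on {a..b}"
    using assms(2) by (auto simp: nth_differentiable_on_def intro: differentiable_on_subset)
  moreover have "nth_deriv_on UNIV j f x = nth_deriv_on {a..b} j g x" if "x \<in> {a..b}" for x
    using nth_deriv_on_interval_eq[OF assms less_imp_le[OF \<open>j < k\<close>] that] by simp
  ultimately show "nth_deriv_on {a..b} j g differentiable_on {a..b}"
    unfolding differentiable_on_def
    by (blast intro: differentiable_transform_within[OF _ zero_less_one])
qed

lemma holder_norm_interval_le:
  assumes "a < b" and "nth_differentiable_on UNIV (sfloor \<beta>) f"
    and eq: "\<And>x. x \<in> {a..b} \<Longrightarrow> g x = f x"
  shows "holder_norm \<beta> {a..b} g \<le> holder_norm \<beta> UNIV f"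
proof -
  have der: "nth_deriv_on {a..b} (sfloor \<beta>) g x = nth_deriv_on UNIV (sfloor \<beta>) f x"
    if "x \<in> {a..b}" for x
    using nth_deriv_on_interval_eq[OF assms order.refl that] by simp
  have "sup_norm {a..b} g \<le> sup_norm UNIV f"
    unfolding sup_norm_def by (rule SUP_mono) (auto simp: eq)
  moreover have "sup_norm {a..b} (nth_deriv_on {a..b} (sfloor \<beta>) g)
      \<le> sup_norm UNIV (nth_deriv_on UNIV (sfloor \<beta>) f)"
    unfolding sup_norm_def by (rule SUP_subset_mono) (simp_all add: der)
  moreover have "holder_seminorm \<beta> {a..b} g \<le> holder_seminorm \<beta> UNIV f"
    unfolding holder_seminorm_def by (rule SUP_mono) (force simp: der)
  ultimately show ?thesis
    unfolding holder_norm_def by (intro add_mono)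
qed

lemma holder_seminorm_bound:
  assumes "holder_seminorm \<beta> \<Omega> f = ennreal M" "0 \<le> M" "x \<in> \<Omega>" "y \<in> \<Omega>"
  shows "\<bar>nth_deriv_on \<Omega> (sfloor \<beta>) f x - nth_deriv_on \<Omega> (sfloor \<beta>) f y\<bar>
    \<le> M * \<bar>x - y\<bar> powr (\<beta> - real (sfloor \<beta>))"
proof (cases "x = y")
  case False
  have "ennreal (\<bar>nth_deriv_on \<Omega> (sfloor \<beta>) f x - nth_deriv_on \<Omega> (sfloor \<beta>) f y\<bar>
      / \<bar>x - y\<bar> powr (\<beta> - real (sfloor \<beta>))) \<le> ennreal M"
    unfolding assms(1)[symmetric] holder_seminorm_def
    by (rule SUP_upper2[of "(x, y)"]) (use assms False in auto)
  then have "\<bar>nth_deriv_on \<Omega> (sfloor \<beta>) f x - nth_deriv_on \<Omega> (sfloor \<beta>) f y\<bar>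
      / \<bar>x - y\<bar> powr (\<beta> - real (sfloor \<beta>)) \<le> M"
    using \<open>0 \<le> M\<close> by simp
  with False show ?thesis by (simp add: field_simps)
qed (use assms in auto)

text \<open>Going a distance \<open>h\<close> downhill lowers the value by \<open>h\<close> times an intermediate slope, and the
  value reached is still nonnegative.\<close>

lemma descent_le_value:
  fixes f f' :: "real \<Rightarrow> real"
  assumes der: "\<And>x. (f has_real_derivative f' x) (at x)"
    and nonneg: "\<And>x. 0 \<le> f x"
    and holder: "\<And>x y. \<bar>f' x - f' y\<bar> \<le> M * \<bar>x - y\<bar> powr \<alpha>"
    and "0 \<le> M" "0 \<le> \<alpha>" "0 < h"
  shows "h * (\<bar>f' x\<bar> - M * h powr \<alpha>) \<le> f x"
proof -
  have slope: "\<bar>f' x - f' z\<bar> \<le> M * h powr \<alpha>" if "\<bar>x - z\<bar> \<le> h" for z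
    using holder[of x z] that assms(4,5)
    by (meson abs_ge_zero mult_left_mono order_trans powr_mono2)
  show ?thesis
  proof (cases "0 \<le> f' x")
    case True
    obtain z where z: "x - h < z" "z < x" "f x - f (x - h) = h * f' z"
      using MVT2[of "x - h" x f f'] der \<open>0 < h\<close> by auto
    have "\<bar>f' x\<bar> - M * h powr \<alpha> \<le> f' z"
      using slope[of z] z True by linarith
    then have "h * (\<bar>f' x\<bar> - M * h powr \<alpha>) \<le> h * f' z"
      using \<open>0 < h\<close> by (intro mult_left_mono) auto
    with z(3) nonneg[of "x - h"] show ?thesis by linarith
  next
    case False
    obtain z where z: "x < z" "z < x + h" "f (x + h) - f x = h * f' z"
      using MVT2[of x "x + h" f f'] der \<open>0 < h\<close> by auto
    have "\<bar>f' x\<bar> - M * h powr \<alpha> \<le> - f' z"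
      using slope[of z] z False by linarith
    then have "h * (\<bar>f' x\<bar> - M * h powr \<alpha>) \<le> h * (- f' z)"
      using \<open>0 < h\<close> by (intro mult_left_mono) auto
    with z(3) nonneg[of "x + h"] show ?thesis by simp
  qed
qed

text \<open>The exponents are forced by optimising the length of the walk: the slope \<open>\<bar>f' x\<bar>\<close> survives
  for a distance of order \<open>(\<bar>f' x\<bar> / M) powr (1 / \<alpha>)\<close>, and slope times distance is at most a
  multiple of \<open>f x\<close>. Halving the slope loses a factor \<open>2\<close> in the distance bound, which becomes
  \<open>2 powr \<alpha>\<close>, and another factor \<open>2\<close> in front of \<open>M\<close>.\<close>

lemma deriv_powr_le:
  fixes f f' :: "real \<Rightarrow> real"
  assumes der: "\<And>x. (f has_real_derivative f' x) (at x)"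
    and nonneg: "\<And>x. 0 \<le> f x"
    and holder: "\<And>x y. \<bar>f' x - f' y\<bar> \<le> M * \<bar>x - y\<bar> powr \<alpha>"
    and "0 \<le> M" "0 < \<alpha>"
  shows "\<bar>f' x\<bar> powr (1 + \<alpha>) \<le> 2 powr (1 + \<alpha>) * M * f x powr \<alpha>"
proof (cases "f' x = 0")
  case True
  with \<open>0 \<le> M\<close> show ?thesis by simp
next
  case False
  define d where "d = \<bar>f' x\<bar>"
  have "0 < d" using False by (simp add: d_def)
  have descent: "h * (d - M * h powr \<alpha>) \<le> f x" if "0 < h" for h
    unfolding d_def using assms that by (intro descent_le_value) auto
  \<comment> \<open>With a constant slope, a long enough walk would reach a negative value.\<close>
  have "M \<noteq> 0"
  proof
    assume "M = 0"
    have "0 < (f x + 1) / d" using nonneg[of x] \<open>0 < d\<close> by simp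
    from descent[OF this] \<open>M = 0\<close> \<open>0 < d\<close> show False by simp
  qed
  with \<open>0 \<le> M\<close> have "0 < M" by simp
  \<comment> \<open>At this distance the slope may have dropped to half its size, but not below.\<close>
  define h where "h = (d / (2 * M)) powr (1 / \<alpha>)"
  have "0 < h" using \<open>0 < d\<close> \<open>0 < M\<close> by (simp add: h_def)
  have h_powr: "h powr \<alpha> = d / (2 * M)"
    using \<open>0 < d\<close> \<open>0 < M\<close> \<open>0 < \<alpha>\<close> by (simp add: h_def powr_powr)
  have "d * h \<le> 2 * f x"
    using descent[OF \<open>0 < h\<close>] \<open>0 < M\<close> by (simp add: h_powr field_simps)
  then have "(d * h) powr \<alpha> \<le> (2 * f x) powr \<alpha>"
    using \<open>0 < d\<close> \<open>0 < h\<close> \<open>0 < \<alpha>\<close> by (intro powr_mono2) auto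
  then have "d powr \<alpha> * (d / (2 * M)) \<le> 2 powr \<alpha> * f x powr \<alpha>"
    using \<open>0 < d\<close> \<open>0 < h\<close> nonneg[of x] by (simp add: powr_mult h_powr)
  then have "d powr \<alpha> * d \<le> 2 * 2 powr \<alpha> * M * f x powr \<alpha>"
    using \<open>0 < M\<close> by (simp add: field_simps)
  then show ?thesis
    using \<open>0 < d\<close> by (simp add: powr_add d_def[symmetric] mult_ac)
qed

lemma flat_seminorm_le:
  assumes "1 < \<beta>" "\<beta> \<le> 2" "0 \<le> \<kappa>"
    and "\<And>x. x \<in> {0..1} \<Longrightarrow>
      \<bar>nth_deriv_on {0..1} 1 f x\<bar> powr \<beta> \<le> \<kappa> * \<bar>f x\<bar> powr (\<beta> - 1)"
  shows "flat_seminorm \<beta> f \<le> ennreal \<kappa>"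
proof -
  have only_1: "j = 1" if "1 \<le> j" "real j < \<beta>" for j :: nat
    using that assms(2) by linarith
  have "\<forall>x\<in>{0..1}. \<forall>j::nat. 1 \<le> j \<and> real j < \<beta> \<longrightarrow>
      \<bar>nth_deriv_on {0..1} j f x\<bar> powr \<beta> \<le> \<kappa> ^ j * \<bar>f x\<bar> powr (\<beta> - real j)"
    using assms(4) only_1 by (metis of_nat_1 power_one_right)
  with assms(1,3) show ?thesis
    by (auto simp: flat_seminorm_def intro!: Inf_lower)
qed

theorem theorem4:
  fixes \<beta> :: real and f :: "real \<Rightarrow> real"
  assumes "0 < \<beta>" and "\<beta> \<le> 2"
    and "f \<in> holder_space \<beta> UNIV"
    and "\<forall>x. 0 \<le> f x"
  shows "restrict f {0..1} \<in> flat_space \<beta> \<and>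
         flat_seminorm \<beta> (restrict f {0..1}) \<le> ennreal (2 powr \<beta>) * holder_seminorm \<beta> UNIV f"
proof -
  let ?g = "restrict f {0..1}"
  have diff: "nth_differentiable_on UNIV (sfloor \<beta>) f" and fin: "holder_norm \<beta> UNIV f < \<infinity>"
    using assms(3) by (auto simp: holder_space_def)
  have eq: "?g x = f x" if "x \<in> {0..1}" for x
    using that by simp
  have g_fin: "holder_norm \<beta> {0..1} ?g < \<infinity>"
    using holder_norm_interval_le[OF zero_less_one diff eq] fin by (rule le_less_trans)
  have g_holder: "?g \<in> holder_space \<beta> {0..1}"
    using nth_differentiable_on_interval[OF zero_less_one diff eq] g_fin
    unfolding holder_space_def by (intro CollectI conjI)
  have semi_fin: "holder_seminorm \<beta> UNIV f < \<infinity>"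
    using fin by (simp add: holder_norm_def)
  then obtain M where M: "holder_seminorm \<beta> UNIV f = ennreal M" "0 \<le> M"
    by (cases "holder_seminorm \<beta> UNIV f") auto
  have flat: "flat_seminorm \<beta> ?g \<le> ennreal (2 powr \<beta>) * holder_seminorm \<beta> UNIV f"
  proof (cases "\<beta> \<le> 1")
    case True
    then show ?thesis by (simp add: flat_seminorm_def)
  next
    case False
    then have "1 < \<beta>" by simp
    note k = sfloor_eq_1[OF this assms(2)]
    let ?f' = "nth_deriv_on UNIV 1 f"
    have der: "(f has_real_derivative ?f' x) (at x)" for x
      using diff
      by (auto simp: k nth_differentiable_on_def differentiable_on_def
          has_real_derivative_iff_has_vector_derivative vector_derivative_works[symmetric])
    have "\<bar>?f' x - ?f' y\<bar> \<le> M * \<bar>x - y\<bar> powr (\<beta> - 1)" for x y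
      using holder_seminorm_bound[OF M, of x y] unfolding k by simp
    from deriv_powr_le[OF der _ this] assms(4) M(2) \<open>1 < \<beta>\<close>
    have "\<bar>?f' x\<bar> powr \<beta> \<le> 2 powr \<beta> * M * f x powr (\<beta> - 1)" for x
      by force
    moreover have "nth_deriv_on {0..1} 1 ?g x = ?f' x" if "x \<in> {0..1}" for x
      using nth_deriv_on_interval_eq[OF zero_less_one diff eq _ that] by (simp only: k order.refl)
    ultimately have "flat_seminorm \<beta> ?g \<le> ennreal (2 powr \<beta> * M)"
      using \<open>1 < \<beta>\<close> assms(2,4) M(2)
      by (intro flat_seminorm_le) (auto simp del: nth_deriv_on.simps One_nat_def)
    then show ?thesis
      using M by (simp add: ennreal_mult)
  qed
  also have "\<dots> < \<infinity>"
    using M by (simp add: ennreal_mult_less_top)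
  finally have "flat_norm \<beta> ?g < \<infinity>"
    using g_fin by (simp add: flat_norm_def)
  with g_holder flat assms(4) show ?thesis
    by (simp add: flat_space_def)
qed

end
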